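(* Assume that $\nu<\infty$ and that the limit $$C_\nu:=\lim_{\gamma\to 0^+}\frac{\gamma}{\gamma+\nu}\,G(\nu+\gamma)$$ exists (as a finite number). Then $$\lim_{t\to\infty}\frac1t\int_0^t e^{-\nu s}\,\mathbb E(N_s)\,ds=C_\nu .$$
   Context: Branching model. $(\mathbb X,\mathcal X)$ is a measurable space, $\xi:\mathbb X\to[0,+\infty)$ and $\kappa:\mathbb X\to\{2,3,\dots\}$ are measurable functions, and $(X_n)_{n\ge 0}$ is an $\mathbb X$-valued process. Cells are labelled by finite sequences $v=(k_1,\dots,k_n)$ of positive integers ($n$ is the generation of $v$; the empty sequence labels the single initial cell, born at time $0$). To each label $v$ is attached an $\mathbb X$-valued random variable $X_v$ in such a way that, along every infinite line of descent $(v_n)_{n\ge0}$ ($v_0=\emptyset$ and $v_{n+1}$ is obtained from $v_n$ by appending one positive integer), the process $(X_{v_n})_{n\ge 0}$ has the same law as $(X_n)_{n\ge 0}$ (parameters on different lines need not be independent). A cell $v$ has lifetime $\xi(X_v)$ and at the end of its lifetime it splits into $\kappa(X_v)$ new cells, labelled by appending $1,\dots,\kappa(X_v)$ to $v$. Thus $v=(k_1,\dots,k_n)$ actually occurs iff $k_{i+1}\le\kappa(X_{(k_1,\dots,k_i)})$ for $0\le i<n$, and it is then alive at time $t$ iff $\sum_{i=0}^{n-1}\xi(X_{(k_1,\dots,k_i)})\le t<\sum_{i=0}^{n}\xi(X_{(k_1,\dots,k_i)})$. $N_t$ is the number of cells alive at time $t$. Notation. $S_n:=\sum_{k=0}^n\xi(X_k)$;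 for $\gamma>0$ and $n\ge0$, $g_n(\gamma):=\mathbb E\big[\big(\prod_{j=0}^{n-1}\kappa(X_j)\big)(\kappa(X_n)-1)e^{-\gamma S_n}\big]$ (empty product $=1$); $G(\gamma):=\sum_{n\ge0}g_n(\gamma)$; $\nu:=\inf\{\gamma>0:\ G(\gamma)<\infty\}$ (with $\inf\emptyset=+\infty$). *)

theory Defs
  imports "HOL-Probability.Probability"
begin

text \<open>
  Cells are labelled by finite lists of positive integers: the list \<open>[k\<^sub>1, \<dots>, k\<^sub>n]\<close>
  has generation \<open>n\<close>, and its ancestor of generation \<open>i\<close> is \<open>take i v\<close>, so that
  \<open>k\<^bsub>i+1\<^esub>\<close> is \<open>v ! i\<close>.
\<close>

definition labels :: "nat list set" where
  "labels = {v. \<forall>k\<in>set v. 1 \<le> k}"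

definition infinite_line :: "(nat \<Rightarrow> nat list) \<Rightarrow> bool" where
  "infinite_line v \<longleftrightarrow> v 0 = [] \<and> (\<forall>n. \<exists>k\<ge>1. v (Suc n) = v n @ [k])"

text \<open>
  \<open>St\<close> is the measurable space of cell parameters. The reference process \<open>X\<close> lives on \<open>P\<close>
  and the cell parameters \<open>Y v\<close> live on \<open>M\<close>; the two spaces are linked only through laws
  (on the product sigma-algebra) and may coincide.
\<close>

locale branching_model =
  P: prob_space P + M: prob_space M
  for P :: "'p measure" and M :: "'m measure" +
  fixes St :: "'x measure"
    and \<xi> :: "'x \<Rightarrow> real"
    and \<kappa> :: "'x \<Rightarrow> nat"
    and X :: "nat \<Rightarrow> 'p \<Rightarrow> 'x"
    and Y :: "nat list \<Rightarrow> 'm \<Rightarrow> 'x"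
  assumes \<xi>_measurable: "\<xi> \<in> borel_measurable St"
    and \<xi>_nonneg: "\<And>x. x \<in> space St \<Longrightarrow> 0 \<le> \<xi> x"
    and \<kappa>_measurable: "\<kappa> \<in> measurable St (count_space UNIV)"
    and \<kappa>_ge_2: "\<And>x. x \<in> space St \<Longrightarrow> 2 \<le> \<kappa> x"
    and X_measurable: "\<And>n. X n \<in> measurable P St"
    and Y_measurable: "\<And>v. v \<in> labels \<Longrightarrow> Y v \<in> measurable M St"
    and same_law: "\<And>v. infinite_line v \<Longrightarrow>
      distr M (Pi\<^sub>M UNIV (\<lambda>_. St)) (\<lambda>\<omega> n. Y (v n) \<omega>) =
      distr P (Pi\<^sub>M UNIV (\<lambda>_. St)) (\<lambda>\<omega> n. X n \<omega>)"

definition occurs ::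
    "('x \<Rightarrow> nat) \<Rightarrow> (nat list \<Rightarrow> 'm \<Rightarrow> 'x) \<Rightarrow> 'm \<Rightarrow> nat list \<Rightarrow> bool" where
  "occurs \<kappa> Y \<omega> v \<longleftrightarrow>
     v \<in> labels \<and> (\<forall>i<length v. v ! i \<le> \<kappa> (Y (take i v) \<omega>))"

definition alive ::
    "('x \<Rightarrow> real) \<Rightarrow> ('x \<Rightarrow> nat) \<Rightarrow> (nat list \<Rightarrow> 'm \<Rightarrow> 'x) \<Rightarrow> real \<Rightarrow> 'm \<Rightarrow> nat list \<Rightarrow> bool"
  where
  "alive \<xi> \<kappa> Y t \<omega> v \<longleftrightarrow>
     occurs \<kappa> Y \<omega> v \<and>
     (\<Sum>i<length v. \<xi> (Y (take i v) \<omega>)) \<le> t \<and>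
     t < (\<Sum>i\<le>length v. \<xi> (Y (take i v) \<omega>))"

text \<open>
  The number of living cells is taken with respect to counting measure, since infinitely many
  cells may be alive when lifetimes accumulate.
\<close>

definition num_alive ::
    "('x \<Rightarrow> real) \<Rightarrow> ('x \<Rightarrow> nat) \<Rightarrow> (nat list \<Rightarrow> 'm \<Rightarrow> 'x) \<Rightarrow> real \<Rightarrow> 'm \<Rightarrow> ennreal" where
  "num_alive \<xi> \<kappa> Y t \<omega> = emeasure (count_space UNIV) {v. alive \<xi> \<kappa> Y t \<omega> v}"

definition S_sum :: "('x \<Rightarrow> real) \<Rightarrow> (nat \<Rightarrow> 'p \<Rightarrow> 'x) \<Rightarrow> nat \<Rightarrow> 'p \<Rightarrow> real" where
  "S_sum \<xi> X n \<omega> = (\<Sum>k\<le>n. \<xi> (X k \<omega>))"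

definition g_fun ::
    "'p measure \<Rightarrow> ('x \<Rightarrow> real) \<Rightarrow> ('x \<Rightarrow> nat) \<Rightarrow> (nat \<Rightarrow> 'p \<Rightarrow> 'x) \<Rightarrow> nat \<Rightarrow> real \<Rightarrow> ennreal"
  where
  "g_fun P \<xi> \<kappa> X n \<gamma> =
     (\<integral>\<^sup>+\<omega>. ennreal ((\<Prod>j<n. real (\<kappa> (X j \<omega>))) * (real (\<kappa> (X n \<omega>)) - 1)
                   * exp (- \<gamma> * S_sum \<xi> X n \<omega>)) \<partial>P)"

definition G_fun ::
    "'p measure \<Rightarrow> ('x \<Rightarrow> real) \<Rightarrow> ('x \<Rightarrow> nat) \<Rightarrow> (nat \<Rightarrow> 'p \<Rightarrow> 'x) \<Rightarrow> real \<Rightarrow> ennreal" where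
  "G_fun P \<xi> \<kappa> X \<gamma> = (\<Sum>n. g_fun P \<xi> \<kappa> X n \<gamma>)"

text \<open>In \<^typ>\<open>ennreal\<close> the infimum of the empty set is \<open>\<infinity>\<close>.\<close>

definition malthus ::
    "'p measure \<Rightarrow> ('x \<Rightarrow> real) \<Rightarrow> ('x \<Rightarrow> nat) \<Rightarrow> (nat \<Rightarrow> 'p \<Rightarrow> 'x) \<Rightarrow> ennreal" where
  "malthus P \<xi> \<kappa> X = (INF \<gamma>\<in>{\<gamma>::real. 0 < \<gamma> \<and> G_fun P \<xi> \<kappa> X \<gamma> < \<infinity>}. ennreal \<gamma>)"

end

theory Submission
  imports Defs
begin

text \<open>
  Summing over the labels of generation \<open>n\<close>, each of which sees the law of \<open>X\<close> along its ancestral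
  line, gives \<open>E N\<^sub>s = \<Sum>\<^sub>n E[W\<^sub>n 1(T\<^sub>n \<le> s < T\<^sub>n\<^sub>+\<^sub>1)]\<close> with \<open>W\<^sub>n = \<Prod>i<n. \<kappa>(X\<^sub>i)\<close> and
  \<open>T\<^sub>n = S\<^sub>n\<^sub>-\<^sub>1\<close>. Taking Laplace transforms, the sum telescopes to
  \<open>\<gamma> \<integral> exp(-\<gamma>s) E N\<^sub>s ds = 1 + G(\<gamma>)\<close> whenever \<open>G(\<gamma>) < \<infinity>\<close>; the remainder vanishes because
  \<open>\<kappa> \<le> 2(\<kappa> - 1)\<close>. At \<open>\<nu> + \<gamma>\<close> this says that the Abel means of \<open>exp(-\<nu>s) E N\<^sub>s\<close> equal
  \<open>\<gamma>/(\<gamma>+\<nu>) (1 + G(\<nu>+\<gamma>))\<close>, and Karamata's Tauberian theorem turns Abel means into Cesaro means.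
  The stray term \<open>\<gamma>/(\<gamma>+\<nu>)\<close> vanishes in the limit only if \<open>\<nu> > 0\<close>; the case \<open>\<nu> = 0\<close> is
  impossible, since \<open>G(\<gamma>) \<longlongrightarrow> \<infinity>\<close> as \<open>\<gamma> \<longlongrightarrow> 0\<close> whatever the model.
\<close>

section \<open>Karamata's Tauberian theorem\<close>

lemma integrable_continuous_AE_Icc:
  fixes h :: "real \<Rightarrow> real"
  assumes "finite_measure D" and sets: "sets D = sets borel" and AE: "AE x in D. x \<in> {a..b}"
    and h: "continuous_on UNIV h"
  shows "integrable D h"
proof -
  interpret finite_measure D by fact
  have "bounded (h ` {a..b})"
    using h by (intro compact_imp_bounded compact_continuous_image) (auto intro: continuous_on_subset)
  then obtain B where B: "\<forall>x\<in>{a..b}. norm (h x) \<le> B"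
    by (auto simp: bounded_iff)
  show ?thesis
  proof (rule integrable_const_bound)
    show "AE x in D. norm (h x) \<le> B" using AE by eventually_elim (use B in auto)
    show "h \<in> borel_measurable D"
      using borel_measurable_continuous_onI[OF h] sets by (simp cong: measurable_cong_sets)
  qed
qed

text \<open>The limits \<open>C / real (Suc k)\<close> are the moments of \<open>C\<close> times
  Lebesgue measure on [0,1]. Linearity extends the convergence to polynomials. Stone-Weierstrass
  extends it to continuous \<open>g\<close>, because the zeroth moment keeps the total masses
  bounded.\<close>

lemma tendsto_integral_of_moments:
  fixes D :: "'i \<Rightarrow> real measure" and g :: "real \<Rightarrow> real"
  assumes fin: "\<forall>\<^sub>F i in F. finite_measure (D i)"
    and sets: "\<And>i. sets (D i) = sets borel"
    and AE: "\<And>i. AE x in D i. x \<in> {0..1}"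
    and moments: "\<And>k. ((\<lambda>i. \<integral>x. x ^ k \<partial>D i) \<longlongrightarrow> C / real (Suc k)) F"
    and g: "continuous_on UNIV g"
  shows "((\<lambda>i. \<integral>x. g x \<partial>D i) \<longlongrightarrow> C * integral {0..1} g) F"
proof (rule tendstoI)
  fix e :: real assume "e > 0"
  note bnd = integrable_continuous_AE_Icc[OF _ sets AE]
  \<comment> \<open>\<open>K\<close> dominates \<bar>C\<bar> and, eventually, the total mass of
    \<open>D i\<close>. The choice of \<open>d\<close> makes each of the two errors from replacing
    \<open>g\<close> by \<open>p\<close>, under \<open>D i\<close> and in the limit, at most
    \<open>d * K = e / 4\<close>. The moments contribute a third \<open>e / 4\<close>.\<close>
  define K where "K = \<bar>C\<bar> + 1"
  have K: "K > 0" unfolding K_def by simp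
  define d where "d = e / (4 * K)"
  have d: "d > 0" using \<open>e > 0\<close> K by (simp add: d_def)
  obtain p where p: "real_polynomial_function p" "\<And>x. x \<in> {0..1} \<Longrightarrow> \<bar>g x - p x\<bar> < d"
    using Stone_Weierstrass_real_polynomial_function[of "{0..1::real}" g d] d
      continuous_on_subset[OF g] by (metis compact_Icc subset_UNIV)
  from p(1) obtain a n where pa: "p = (\<lambda>x. \<Sum>k\<le>n. a k * x ^ k)"
    unfolding real_polynomial_function_iff_sum by blast
  have cp: "continuous_on UNIV p" unfolding pa by (intro continuous_intros)
  have pint: "integral {0..1} p = (\<Sum>k\<le>n. a k * (1 / real (Suc k)))"
  proof (rule integral_unique)
    have pow: "((\<lambda>x::real. x ^ k) has_integral 1 / real (Suc k)) {0..1}" for k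
    proof -
      have "((\<lambda>x::real. x ^ k) has_integral 1 ^ Suc k / real (Suc k) - 0 ^ Suc k / real (Suc k)) {0..1}"
        by (rule fundamental_theorem_of_calculus)
           (auto intro!: derivative_eq_intros simp del: power_Suc of_nat_Suc
              simp flip: has_real_derivative_iff_has_vector_derivative)
      then show ?thesis by simp
    qed
    show "(p has_integral (\<Sum>k\<le>n. a k * (1 / real (Suc k)))) {0..1}"
      unfolding pa by (intro has_integral_sum has_integral_mult_right pow) simp
  qed
  have pc: "((\<lambda>i. \<Sum>k\<le>n. a k * (\<integral>x. x ^ k \<partial>D i)) \<longlongrightarrow> C * integral {0..1} p) F"
    unfolding pint sum_distrib_left
    using moments by (auto intro!: tendsto_eq_intros sum.cong)
  have lim_int: "\<bar>integral {0..1} p - integral {0..1} g\<bar> \<le> d"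
  proof -
    have "norm (integral {0..1} (\<lambda>x. p x - g x)) \<le> d * (1 - 0)"
      by (rule integral_bound)
         (use p(2) g cp in \<open>auto simp: abs_minus_commute less_imp_le intro!: continuous_intros intro: continuous_on_subset\<close>)
    then show ?thesis
      using g cp by (subst (asm) Henstock_Kurzweil_Integration.integral_diff)
        (auto intro!: integrable_continuous_real intro: continuous_on_subset)
  qed
  have tot: "((\<lambda>i. measure (D i) UNIV) \<longlongrightarrow> C) F"
    using moments[of 0] sets_eq_imp_space_eq[OF sets] by simp
  have "\<forall>\<^sub>F i in F. measure (D i) UNIV < K"
    by (rule order_tendstoD[OF tot]) (simp add: K_def)
  moreover have "\<forall>\<^sub>F i in F. dist (\<Sum>k\<le>n. a k * (\<integral>x. x ^ k \<partial>D i)) (C * integral {0..1} p) < e / 4"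
    using tendstoD[OF pc, of "e/4"] \<open>e > 0\<close> by simp
  ultimately show "\<forall>\<^sub>F i in F. dist (\<integral>x. g x \<partial>D i) (C * integral {0..1} g) < e"
    using fin
  proof eventually_elim
    case (elim i)
    interpret finite_measure "D i" by fact
    have sp: "space (D i) = UNIV" using sets_eq_imp_space_eq[OF sets] by simp
    note int = bnd[OF elim(3)]
    have ip: "(\<integral>x. p x \<partial>D i) = (\<Sum>k\<le>n. a k * (\<integral>x. x ^ k \<partial>D i))"
      unfolding pa by (subst Bochner_Integration.integral_sum) (auto intro!: int continuous_intros)
    have aep: "AE x in D i. \<bar>g x - p x\<bar> \<le> d"
      using AE[of i] by eventually_elim (use p(2) in \<open>auto simp: less_imp_le\<close>)
    have "\<bar>(\<integral>x. g x \<partial>D i) - (\<integral>x. p x \<partial>D i)\<bar> = \<bar>\<integral>x. g x - p x \<partial>D i\<bar>"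
      using int g cp by simp
    also have "\<dots> \<le> (\<integral>x. \<bar>g x - p x\<bar> \<partial>D i)" by (rule integral_abs_bound)
    also have "\<dots> \<le> (\<integral>x. d \<partial>D i)"
      by (intro integral_mono_AE int continuous_intros g cp aep)
    also have "\<dots> \<le> d * K" using elim(1) d sp by simp
    finally have 1: "\<bar>(\<integral>x. g x \<partial>D i) - (\<integral>x. p x \<partial>D i)\<bar> \<le> d * K" .
    have "\<bar>C * integral {0..1} p - C * integral {0..1} g\<bar> = \<bar>C\<bar> * \<bar>integral {0..1} p - integral {0..1} g\<bar>"
      by (simp add: abs_mult flip: right_diff_distrib)
    also have "\<dots> \<le> K * d"
      using lim_int by (intro mult_mono) (auto simp: K_def)
    finally have 2: "\<bar>C * integral {0..1} p - C * integral {0..1} g\<bar> \<le> K * d" .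
    have 3: "K * d = e / 4" using K by (simp add: d_def)
    show ?case
      using 1 2 elim(2) \<open>e > 0\<close> unfolding ip 3 mult.commute[of d] dist_real_def by linarith
  qed
qed

text \<open>\<open>q\<close> is a continuous majorant of 1/x cut off to x \<ge> a. It climbs
  linearly on [a - d, a], and \<open>max x a\<close> keeps the quotient continuous down to 0. The
  ramp has length \<open>d\<close> and height at most 1/a, so it costs at most \<open>d / a\<close>,
  while [a, 1] yields \<open>- ln a\<close>.\<close>

lemma cutoff_above:
  fixes a d :: real
  assumes "0 < d" "d < a" "a < 1"
  defines "q \<equiv> (\<lambda>x. max 0 (min 1 ((x - (a - d)) / d)) / max x a)"
  shows "integral {0..1} q \<le> d / a - ln a"
proof -
  have q: "continuous_on S q" for S
    unfolding q_def using assms by (intro continuous_intros) auto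
  have qi: "q integrable_on {u..v}" for u v
    by (intro integrable_continuous_real q)
  have "integral {0..1} q = integral {0..a-d} q + (integral {a-d..a} q + integral {a..1} q)"
    using assms qi by (simp add: Henstock_Kurzweil_Integration.integral_combine)
  moreover have "integral {0..a-d} q = 0"
    by (rule integral_unique, rule has_integral_is_0) (use assms in \<open>auto simp: q_def field_simps max_def\<close>)
  moreover have "integral {a-d..a} q \<le> d / a"
  proof -
    have "norm (integral {a-d..a} q) \<le> (1 / a) * (a - (a - d))"
    proof (rule integral_bound)
      fix x
      have "norm (q x) = max 0 (min 1 ((x - (a - d)) / d)) / max x a"
        using assms by (simp add: q_def)
      also have "\<dots> \<le> 1 / a"
        using assms by (intro frac_le) auto
      finally show "norm (q x) \<le> 1 / a" .
    qed (use assms q in auto)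
    then show ?thesis by simp
  qed
  moreover have "integral {a..1} q = - ln a"
  proof -
    have "((\<lambda>x. 1 / x) has_integral (ln 1 - ln a)) {a..1}"
      using assms
      by (intro fundamental_theorem_of_calculus)
         (auto intro!: derivative_eq_intros simp flip: has_real_derivative_iff_has_vector_derivative)
    then have "(q has_integral (ln 1 - ln a)) {a..1}"
      by (rule has_integral_eq[rotated]) (use assms in \<open>auto simp: q_def max_def min_def field_simps\<close>)
    then show ?thesis by (simp add: integral_unique)
  qed
  ultimately show ?thesis by simp
qed

text \<open>The matching minorant: the ramp now sits on [a, a + d], and its nonnegative contribution
  is discarded.\<close>

lemma cutoff_below:
  fixes a d :: real
  assumes "0 < d" "0 < a" "a + d < 1"
  defines "q \<equiv> (\<lambda>x. max 0 (min 1 ((x - a) / d)) / max x a)"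
  shows "integral {0..1} q \<ge> - ln (a + d)"
proof -
  have q: "continuous_on S q" for S
    unfolding q_def using assms by (intro continuous_intros) auto
  have qi: "q integrable_on {u..v}" for u v
    by (intro integrable_continuous_real q)
  have "integral {0..1} q = integral {0..a+d} q + integral {a+d..1} q"
    using assms qi by (simp add: Henstock_Kurzweil_Integration.integral_combine)
  moreover have "integral {0..a+d} q \<ge> 0"
    by (rule integral_nonneg[OF qi]) (use assms in \<open>auto simp: q_def\<close>)
  moreover have "integral {a+d..1} q = - ln (a + d)"
  proof -
    have "((\<lambda>x. 1 / x) has_integral (ln 1 - ln (a + d))) {a+d..1}"
      using assms
      by (intro fundamental_theorem_of_calculus)
         (auto intro!: derivative_eq_intros simp flip: has_real_derivative_iff_has_vector_derivative)
    then have "(q has_integral (ln 1 - ln (a + d))) {a+d..1}"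
      by (rule has_integral_eq[rotated]) (use assms in \<open>auto simp: q_def max_def min_def field_simps\<close>)
    then show ?thesis by (simp add: integral_unique)
  qed
  ultimately show ?thesis by simp
qed


theorem karamata_tauberian:
  fixes N :: "real measure" and C :: real
  assumes sets: "sets N = sets borel" and "C \<ge> 0"
    and lim: "((\<lambda>\<gamma>. ennreal \<gamma> * (\<integral>\<^sup>+s. ennreal (exp (- \<gamma> * s)) * indicator {0..} s \<partial>N)) \<longlongrightarrow> ennreal C)
      (at_right 0)"
  shows "((\<lambda>t. ennreal (1 / t) * emeasure N {0..t}) \<longlongrightarrow> ennreal C) at_top"
proof -
  have [measurable_cong]: "sets N = sets borel" by (rule sets)
  \<comment> \<open>Under \<open>x = exp (- \<gamma> s)\<close> the hypothesis says that all moments of \<open>D \<gamma>\<close> converge to those of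
    \<open>C\<close> times Lebesgue measure on \<open>[0, 1]\<close>, while \<open>\<gamma> N [0, 1/\<gamma>]\<close> is the integral of \<open>h\<close> below.\<close>
  define D where "D \<gamma> = distr (density N (\<lambda>s. ennreal (\<gamma> * exp (- \<gamma> * s)) * indicator {0..} s)) borel
    (\<lambda>s. exp (- \<gamma> * s))" for \<gamma> :: real
  define F where "F \<gamma> = ennreal \<gamma> * (\<integral>\<^sup>+s. ennreal (exp (- \<gamma> * s)) * indicator {0..} s \<partial>N)" for \<gamma> :: real
  have lim: "(F \<longlongrightarrow> ennreal C) (at_right 0)" unfolding F_def[abs_def] by (rule lim)
  have sD [measurable_cong]: "sets (D \<gamma>) = sets borel" for \<gamma> by (simp add: D_def)
  have nnD: "(\<integral>\<^sup>+x. f x \<partial>D \<gamma>) =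
      (\<integral>\<^sup>+s. ennreal (\<gamma> * exp (- \<gamma> * s)) * indicator {0..} s * f (exp (- \<gamma> * s)) \<partial>N)"
    if [measurable]: "f \<in> borel_measurable borel" for f \<gamma>
    unfolding D_def by (simp add: nn_integral_distr nn_integral_density)
  have AE: "AE x in D \<gamma>. x \<in> {0..1}" for \<gamma>
  proof -
    \<comment> \<open>For \<gamma> \<le> 0 the density is \<open>ennreal\<close> of a nonpositive
      number, hence 0, so \<open>D \<gamma>\<close> is the null measure. The support claim therefore
      holds for every real \<gamma>.\<close>
    have "exp (- \<gamma> * s) \<le> 1" if "0 < ennreal (\<gamma> * exp (- \<gamma> * s)) * indicator {0..} s" for s
    proof -
      have "\<gamma> > 0" "s \<ge> 0"
        using that by (cases "s \<ge> 0"; simp add: ennreal_less_zero_iff zero_less_mult_iff)+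
      then show ?thesis by simp
    qed
    then show ?thesis
      unfolding D_def by (subst AE_distr_iff) (auto simp: AE_density)
  qed
  \<comment> \<open>The weight exp(-\<gamma>s) and the power exp(-\<gamma>s)^k merge into a Laplace
    transform at (k+1)\<gamma>. Normalising its prefactor \<gamma> to (k+1)\<gamma> leaves the
    factor 1/(k+1).\<close>
  have nn_moment: "(\<integral>\<^sup>+x. ennreal (x ^ k) \<partial>D \<gamma>) = ennreal (1 / real (Suc k)) * F (real (Suc k) * \<gamma>)"
    if "\<gamma> > 0" for \<gamma> k
  proof -
    have exp_eq: "exp (- \<gamma> * s) * exp (- \<gamma> * s) ^ k = exp (- (real (Suc k) * \<gamma>) * s)" for s
      by (simp add: exp_of_nat_mult[symmetric] mult_exp_exp algebra_simps)
    have "(\<integral>\<^sup>+x. ennreal (x ^ k) \<partial>D \<gamma>) =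
        (\<integral>\<^sup>+s. ennreal \<gamma> * (ennreal (exp (- (real (Suc k) * \<gamma>) * s)) * indicator {0..} s) \<partial>N)"
      using that
      unfolding exp_eq[symmetric]
      by (subst nnD, simp, intro nn_integral_cong)
         (auto simp: indicator_def ennreal_mult' mult_ac)
    also have "\<dots> = ennreal \<gamma> * (\<integral>\<^sup>+s. ennreal (exp (- (real (Suc k) * \<gamma>) * s)) * indicator {0..} s \<partial>N)"
      by (rule nn_integral_cmult) simp
    also have "ennreal \<gamma> = ennreal (1 / real (Suc k)) * ennreal (real (Suc k) * \<gamma>)"
      using that by (subst ennreal_mult[symmetric]) (auto simp del: of_nat_Suc)
    finally show ?thesis by (simp add: F_def mult.assoc)
  qed
  have pos: "\<forall>\<^sub>F \<gamma> in at_right 0. (\<gamma>::real) > 0" by (rule eventually_at_right_less)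
  have nn_lim: "((\<lambda>\<gamma>. \<integral>\<^sup>+x. ennreal (x ^ k) \<partial>D \<gamma>) \<longlongrightarrow> ennreal (C / real (Suc k))) (at_right 0)" for k
  proof -
    have "filterlim (\<lambda>\<gamma>. real (Suc k) * \<gamma>) (at_right 0) (at_right 0)"
      by (rule filterlim_times_pos[where p = 0, simplified]) (auto simp: filterlim_ident)
    from tendsto_mult_ennreal[OF tendsto_const filterlim_compose[OF lim this], of "ennreal (1 / real (Suc k))"]
    have "((\<lambda>\<gamma>. ennreal (1 / real (Suc k)) * F (real (Suc k) * \<gamma>)) \<longlongrightarrow> ennreal (1 / real (Suc k)) * ennreal C) (at_right 0)"
      by simp
    also have "ennreal (1 / real (Suc k)) * ennreal C = ennreal (C / real (Suc k))"
      using \<open>C \<ge> 0\<close> by (subst ennreal_mult[symmetric]) auto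
    finally show ?thesis
      by (rule Lim_transform_eventually) (use pos nn_moment in \<open>auto elim!: eventually_mono\<close>)
  qed
  have moments: "((\<lambda>\<gamma>. \<integral>x. x ^ k \<partial>D \<gamma>) \<longlongrightarrow> C / real (Suc k)) (at_right 0)" for k
  proof -
    have "(\<integral>x. x ^ k \<partial>D \<gamma>) = enn2real (\<integral>\<^sup>+x. ennreal (x ^ k) \<partial>D \<gamma>)" for \<gamma>
      by (rule integral_eq_nn_integral) (use AE[of \<gamma>] in \<open>auto elim!: eventually_mono\<close>)
    then show ?thesis
      using nn_lim[of k] \<open>C \<ge> 0\<close> by (simp add: tendsto_enn2real del: of_nat_Suc)
  qed
  have fin: "\<forall>\<^sub>F \<gamma> in at_right 0. finite_measure (D \<gamma>)"
  proof -
    have "\<forall>\<^sub>F \<gamma> in at_right 0. (\<integral>\<^sup>+x. ennreal (x ^ 0) \<partial>D \<gamma>) < \<infinity>"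
      by (rule order_tendstoD[OF nn_lim]) simp
    then show ?thesis
      by eventually_elim (auto intro!: finite_measureI)
  qed
  note int = integrable_continuous_AE_Icc[OF _ sD AE]
  note conv = tendsto_integral_of_moments[OF fin sD AE moments]
  \<comment> \<open>With x = exp(-\<gamma>s), the condition x \<ge> a means s \<le> 1/\<gamma>, and
    dividing by x in \<open>h\<close> cancels the exponential weight of \<open>D \<gamma>\<close>.
    Since \<open>ln a = -1\<close>, the Lebesgue integral of \<open>h\<close> over [0,1] is 1, so
    the expected limit is exactly \<open>C\<close>.\<close>
  define a :: real where "a = exp (-1)"
  have a: "0 < a" "a < 1" "ln a = -1" by (auto simp: a_def)
  define h where "h x = indicator {a..} x / x" for x :: real
  have [measurable]: "h \<in> borel_measurable borel" unfolding h_def by measurable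
  have h_int: "integrable (D \<gamma>) h" if "finite_measure (D \<gamma>)" for \<gamma>
  proof -
    interpret finite_measure "D \<gamma>" by fact
    have "norm (h x) \<le> 1 / a" for x
      using a by (auto simp: h_def indicator_def intro!: frac_le)
    then show ?thesis
      by (intro integrable_const_bound[where B = "1 / a"]) auto
  qed
  \<comment> \<open>\<open>h\<close> jumps at \<open>a\<close>, so \<open>conv\<close> does not
    apply to it directly. It is squeezed between continuous cutoffs whose integrals tend to 1 as the
    ramp width \<open>d\<close> tends to 0.\<close>
  have h_lim: "((\<lambda>\<gamma>. \<integral>x. h x \<partial>D \<gamma>) \<longlongrightarrow> C) (at_right 0)"
  proof (rule order_tendstoI)
    fix c assume c: "c < C"
    have "((\<lambda>d. C * (- ln (a + d))) \<longlongrightarrow> C * (- ln (a + 0))) (at_right 0)"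
      using a by (intro tendsto_intros) auto
    then have "\<forall>\<^sub>F d in at_right 0. C * (- ln (a + d)) > c"
      by (rule order_tendstoD) (use a c in simp)
    moreover have "\<forall>\<^sub>F d in at_right 0. d < 1 - a"
      using eventually_at_right_real[of 0 "1 - a"] a by (auto elim!: eventually_mono)
    ultimately have "\<forall>\<^sub>F d in at_right 0. d > 0 \<and> d < 1 - a \<and> C * (- ln (a + d)) > c"
      using eventually_at_right_less[of 0] by eventually_elim auto
    then obtain d where d: "d > 0" "d < 1 - a" "C * (- ln (a + d)) > c"
      using eventually_happens by force
    define q where "q x = max 0 (min 1 ((x - a) / d)) / max x a" for x
    have q: "continuous_on UNIV q"
      unfolding q_def using a d by (intro continuous_intros) auto
    have "C * (- ln (a + d)) \<le> C * integral {0..1} q"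
      using cutoff_below[of d a] a d \<open>C \<ge> 0\<close> unfolding q_def[abs_def] by (intro mult_left_mono) auto
    with d have "\<forall>\<^sub>F \<gamma> in at_right 0. c < (\<integral>x. q x \<partial>D \<gamma>)"
      by (intro order_tendstoD[OF conv[OF q]]) simp
    then show "\<forall>\<^sub>F \<gamma> in at_right 0. c < (\<integral>x. h x \<partial>D \<gamma>)"
      using fin
    proof eventually_elim
      case (elim \<gamma>)
      have "(\<integral>x. q x \<partial>D \<gamma>) \<le> (\<integral>x. h x \<partial>D \<gamma>)"
        using a d
        by (intro integral_mono int h_int elim q)
           (auto simp: q_def h_def indicator_def max_def divide_simps)
      with elim show ?case by simp
    qed
  next
    fix c assume c: "C < c"
    have "((\<lambda>d. C * (d / a - ln a)) \<longlongrightarrow> C * (0 / a - ln a)) (at_right 0)"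
      using a by (intro tendsto_intros) auto
    then have "\<forall>\<^sub>F d in at_right 0. C * (d / a - ln a) < c"
      by (rule order_tendstoD) (use a c in simp)
    moreover have "\<forall>\<^sub>F d in at_right 0. d < a"
      using a by (intro eventually_at_right_real[THEN eventually_mono]) auto
    ultimately have "\<forall>\<^sub>F d in at_right 0. d > 0 \<and> d < a \<and> C * (d / a - ln a) < c"
      using eventually_at_right_less[of 0] by eventually_elim auto
    then obtain d where d: "d > 0" "d < a" "C * (d / a - ln a) < c"
      using eventually_happens by force
    define q where "q x = max 0 (min 1 ((x - (a - d)) / d)) / max x a" for x
    have q: "continuous_on UNIV q"
      unfolding q_def using a d by (intro continuous_intros) auto
    have "C * integral {0..1} q \<le> C * (d / a - ln a)"
      using cutoff_above[of d a] a d \<open>C \<ge> 0\<close> unfolding q_def[abs_def] by (intro mult_left_mono) auto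
    with d have "\<forall>\<^sub>F \<gamma> in at_right 0. (\<integral>x. q x \<partial>D \<gamma>) < c"
      by (intro order_tendstoD[OF conv[OF q]]) simp
    then show "\<forall>\<^sub>F \<gamma> in at_right 0. (\<integral>x. h x \<partial>D \<gamma>) < c"
      using fin
    proof eventually_elim
      case (elim \<gamma>)
      have "(\<integral>x. h x \<partial>D \<gamma>) \<le> (\<integral>x. q x \<partial>D \<gamma>)"
        using a d
        by (intro integral_mono int h_int elim q)
           (auto simp: q_def h_def indicator_def max_def divide_simps)
      with elim show ?case by simp
    qed
  qed
  have "((\<lambda>\<gamma>. ennreal (\<integral>x. h x \<partial>D \<gamma>)) \<longlongrightarrow> ennreal C) (at_right 0)"
    by (rule tendsto_ennrealI[OF h_lim])
  then have "((\<lambda>\<gamma>. ennreal \<gamma> * emeasure N {0..1 / \<gamma>}) \<longlongrightarrow> ennreal C) (at_right 0)"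
  proof (rule Lim_transform_eventually)
    show "\<forall>\<^sub>F \<gamma> in at_right 0. ennreal (\<integral>x. h x \<partial>D \<gamma>) = ennreal \<gamma> * emeasure N {0..1 / \<gamma>}"
      using fin pos
    proof eventually_elim
      case (elim \<gamma>)
      have "ennreal (\<integral>x. h x \<partial>D \<gamma>) = (\<integral>\<^sup>+x. ennreal (h x) \<partial>D \<gamma>)"
        using a by (intro nn_integral_eq_integral[symmetric] h_int elim)
          (auto simp: h_def indicator_def)
      also have "\<dots> = (\<integral>\<^sup>+s. ennreal \<gamma> * indicator {0..1 / \<gamma>} s \<partial>N)"
        using elim(2)
        by (subst nnD)
           (auto intro!: nn_integral_cong simp: h_def a_def indicator_def field_simps simp flip: ennreal_mult)
      also have "\<dots> = ennreal \<gamma> * emeasure N {0..1 / \<gamma>}"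
        by (simp add: nn_integral_cmult_indicator)
      finally show ?case .
    qed
  qed
  from filterlim_compose[OF this filterlim_inverse_at_right_top] show ?thesis
    by (simp add: inverse_eq_divide)
qed


section \<open>Expected number of living cells\<close>

text \<open>A label of length n + 1 is one of length n with a last letter appended, so each
  generation multiplies the count by \<open>K n\<close>. Finiteness is carried along because
  counting measure agrees with \<open>card\<close> only on finite sets.\<close>

lemma card_bounded_lists:
  "finite {v. length v = n \<and> (\<forall>i<n. 1 \<le> v ! i \<and> v ! i \<le> (K i :: nat))} \<and>
   card {v. length v = n \<and> (\<forall>i<n. 1 \<le> v ! i \<and> v ! i \<le> K i)} = (\<Prod>i<n. K i)"
proof (induction n)
  case 0
  then show ?case by simp
next
  case (Suc n)
  let ?B = "\<lambda>n. {v. length v = n \<and> (\<forall>i<n. 1 \<le> v ! i \<and> v ! i \<le> K i)}"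
  have eq: "?B (Suc n) = (\<lambda>(v, k). v @ [k]) ` (?B n \<times> {1..K n})"
  proof (intro equalityI subsetI)
    fix v assume v: "v \<in> ?B (Suc n)"
    then have "v = butlast v @ [last v]" by (cases v rule: rev_cases) auto
    moreover have "last v = v ! n" using v by (cases v rule: rev_cases) (auto simp: nth_append)
    ultimately show "v \<in> (\<lambda>(v, k). v @ [k]) ` (?B n \<times> {1..K n})"
      using v by (intro image_eqI[of _ _ "(butlast v, last v)"]) (auto simp: nth_butlast)
  qed (auto simp: nth_append less_Suc_eq)
  have inj: "inj_on (\<lambda>(v, k). v @ [k]) (?B n \<times> {1..K n})"
    by (auto simp: inj_on_def)
  show ?case unfolding eq using Suc inj
    by (simp add: card_image card_cartesian_product)
qed

lemma countable_labels: "countable labels"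
  by (rule countableI_type)

text \<open>\<open>\<lambda>v. X (length v)\<close> describes a comparison tree on the space of
  \<open>X\<close>, in which all cells of a generation share one parameter. The ancestor
  \<open>take i v\<close> then carries \<open>X i\<close>.\<close>

lemma alive_generation:
  "alive \<xi> \<kappa> (\<lambda>v. X (length v)) s \<omega> v \<longleftrightarrow>
    v \<in> labels \<and> (\<forall>i<length v. v ! i \<le> \<kappa> (X i \<omega>)) \<and>
    (\<Sum>i<length v. \<xi> (X i \<omega>)) \<le> s \<and> s < (\<Sum>i<Suc (length v). \<xi> (X i \<omega>))"
proof -
  have "(\<Sum>i\<in>A. \<xi> (X (length (take i v)) \<omega>)) = (\<Sum>i\<in>A. \<xi> (X i \<omega>))" if "A \<subseteq> {..length v}" for A
    by (intro sum.cong) (use that in \<open>auto simp: min_absorb2\<close>)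
  from this[of "{..<length v}"] this[of "{..length v}"] show ?thesis
    by (auto simp: alive_def occurs_def lessThan_Suc_atMost)
qed

text \<open>In the comparison tree all cells of a generation are born and split simultaneously, so a
  generation counts either entirely or not at all.\<close>

lemma num_alive_generation:
  "num_alive \<xi> \<kappa> (\<lambda>v. X (length v)) s \<omega> =
    (\<Sum>n. ennreal (\<Prod>i<n. real (\<kappa> (X i \<omega>))) *
      indicator {(\<Sum>i<n. \<xi> (X i \<omega>))..<(\<Sum>i<Suc n. \<xi> (X i \<omega>))} s)"
proof -
  define K where "K i = \<kappa> (X i \<omega>)" for i
  define I where "I n = {(\<Sum>i<n. \<xi> (X i \<omega>))..<(\<Sum>i<Suc n. \<xi> (X i \<omega>))}" for n
  define B where "B n = {v. length v = n \<and> (\<forall>i<n. 1 \<le> v ! i \<and> v ! i \<le> K i)}" for n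
  define A where "A n = (if s \<in> I n then B n else {})" for n
  have alive: "alive \<xi> \<kappa> (\<lambda>v. X (length v)) s \<omega> v \<longleftrightarrow> s \<in> I (length v) \<and> v \<in> B (length v)" for v
    unfolding alive_generation labels_def all_set_conv_all_nth I_def B_def K_def
      atLeastLessThan_iff mem_Collect_eq by blast
  have len: "length v = n" if "v \<in> B n" for v n
    using that by (simp add: B_def)
  have "{v. alive \<xi> \<kappa> (\<lambda>v. X (length v)) s \<omega> v} = (\<Union>n. A n)"
    unfolding alive A_def using len by (auto split: if_splits)
  also have "emeasure (count_space UNIV) \<dots> = (\<Sum>n. emeasure (count_space UNIV) (A n))"
    by (rule suminf_emeasure[symmetric]) (use len in \<open>auto simp: disjoint_family_on_def A_def\<close>)
  also have "\<dots> = (\<Sum>n. ennreal (\<Prod>i<n. real (K i)) * indicator (I n) s)"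
  proof (rule suminf_cong)
    fix n
    have "finite (B n)" "card (B n) = (\<Prod>i<n. K i)"
      using card_bounded_lists[of n K] unfolding B_def by blast+
    then have "emeasure (count_space UNIV) (B n) = ennreal (\<Prod>i<n. real (K i))"
      by (simp add: ennreal_of_nat_eq_real_of_nat)
    then show "emeasure (count_space UNIV) (A n) = ennreal (\<Prod>i<n. real (K i)) * indicator (I n) s"
      by (simp add: A_def)
  qed
  finally show ?thesis unfolding num_alive_def K_def I_def .
qed

text \<open>Writing the count as an integral over the countable set \<open>labels\<close> turns the
  exchange of expectation and sum over cells into an interchange of integrals.\<close>

lemma num_alive_eq_nn_integral:
  "num_alive \<xi> \<kappa> Z s \<omega> = (\<integral>\<^sup>+v. of_bool (alive \<xi> \<kappa> Z s \<omega> v) \<partial>count_space labels)"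
proof -
  have "num_alive \<xi> \<kappa> Z s \<omega> = (\<integral>\<^sup>+v. indicator {v. alive \<xi> \<kappa> Z s \<omega> v} v \<partial>count_space UNIV)"
    unfolding num_alive_def by (rule nn_integral_indicator[symmetric]) simp
  also have "\<dots> = (\<integral>\<^sup>+v. indicator {v. alive \<xi> \<kappa> Z s \<omega> v} v \<partial>count_space labels)"
    by (rule nn_integral_count_space_eq) (auto simp: alive_def occurs_def)
  finally show ?thesis by (simp add: indicator_def)
qed

section \<open>Lines of descent and the many-to-one formula\<close>

text \<open>\<open>same_law\<close> speaks of infinite lines only, so a finite label is prolonged by
  always following the first child. Up to generation \<open>length v\<close> the line consists of
  the ancestors \<open>take n v\<close>.\<close>

definition descent :: "nat list \<Rightarrow> nat \<Rightarrow> nat list" where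
  "descent v n = take n v @ replicate (n - length v) 1"

lemma infinite_line_descent: "v \<in> labels \<Longrightarrow> infinite_line (descent v)"
proof -
  assume v: "v \<in> labels"
  have "\<exists>k\<ge>1. descent v (Suc n) = descent v n @ [k]" for n
  proof (cases "n < length v")
    case True
    with v have "v ! n \<ge> 1" by (auto simp: labels_def)
    with True show ?thesis by (auto simp: descent_def take_Suc_conv_app_nth)
  next
    case False
    then show ?thesis
      by (auto simp: descent_def Suc_diff_le replicate_append_same)
  qed
  then show ?thesis by (simp add: infinite_line_def descent_def)
qed

lemma descent_in_labels: "v \<in> labels \<Longrightarrow> descent v n \<in> labels"
  by (auto simp: descent_def labels_def dest: in_set_takeD)

context branching_model
begin

lemmas [measurable] = \<xi>_measurable \<kappa>_measurable X_measurable

lemma X_space [simp]: "\<omega> \<in> space P \<Longrightarrow> X n \<omega> \<in> space St"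
  using X_measurable by (rule measurable_space)

lemma kappa_X: "\<omega> \<in> space P \<Longrightarrow> 2 \<le> real (\<kappa> (X n \<omega>))"
  using \<kappa>_ge_2[of "X n \<omega>"] by simp

lemma xi_X: "\<omega> \<in> space P \<Longrightarrow> 0 \<le> \<xi> (X n \<omega>)"
  by (rule \<xi>_nonneg) simp

lemma expectation_line:
  assumes v: "v \<in> labels" and f [measurable]: "f \<in> borel_measurable (Pi\<^sub>M UNIV (\<lambda>_. St))"
  shows "(\<integral>\<^sup>+\<omega>. f (\<lambda>n. Y (descent v n) \<omega>) \<partial>M) = (\<integral>\<^sup>+\<omega>. f (\<lambda>n. X n \<omega>) \<partial>P)"
proof -
  have [measurable]: "(\<lambda>\<omega> n. Y (descent v n) \<omega>) \<in> measurable M (Pi\<^sub>M UNIV (\<lambda>_. St))"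
    by (rule measurable_PiM_single') (use Y_measurable descent_in_labels[OF v] in \<open>auto dest: measurable_space\<close>)
  have [measurable]: "(\<lambda>\<omega> n. X n \<omega>) \<in> measurable P (Pi\<^sub>M UNIV (\<lambda>_. St))"
    by (rule measurable_PiM_single') auto
  have "(\<integral>\<^sup>+\<omega>. f (\<lambda>n. Y (descent v n) \<omega>) \<partial>M) =
      (\<integral>\<^sup>+x. f x \<partial>distr M (Pi\<^sub>M UNIV (\<lambda>_. St)) (\<lambda>\<omega> n. Y (descent v n) \<omega>))"
    by (simp add: nn_integral_distr)
  also have "\<dots> = (\<integral>\<^sup>+x. f x \<partial>distr P (Pi\<^sub>M UNIV (\<lambda>_. St)) (\<lambda>\<omega> n. X n \<omega>))"
    by (simp add: same_law[OF infinite_line_descent[OF v]])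
  finally show ?thesis by (simp add: nn_integral_distr)
qed

text \<open>Whether \<open>v\<close> is alive depends only on the parameters along its own ancestral
  line, whose law is that of \<open>X\<close>. Expectation is additive over labels, so dependence
  between lines does not matter and the tree may be replaced by the comparison tree.\<close>

lemma many_to_one:
  "(\<integral>\<^sup>+\<omega>. num_alive \<xi> \<kappa> Y s \<omega> \<partial>M) = (\<integral>\<^sup>+\<omega>. num_alive \<xi> \<kappa> (\<lambda>v. X (length v)) s \<omega> \<partial>P)"
proof -
  \<comment> \<open>\<open>f v\<close> expresses being alive as a function of a parameter sequence.
    It reads only the coordinates up to \<open>length v\<close>, where \<open>descent v\<close> runs
    through the ancestors of \<open>v\<close>.\<close>
  define f where "f v x = (of_bool ((\<forall>i<length v. v ! i \<le> \<kappa> (x i)) \<and>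
      (\<Sum>i<length v. \<xi> (x i)) \<le> s \<and> s < (\<Sum>i\<le>length v. \<xi> (x i))) :: ennreal)" for v x
  have f [measurable]: "f v \<in> borel_measurable (Pi\<^sub>M UNIV (\<lambda>_. St))" for v
    unfolding f_def by measurable
  have fY: "of_bool (alive \<xi> \<kappa> Y s \<omega> v) = f v (\<lambda>n. Y (descent v n) \<omega>)" if "v \<in> labels" for v \<omega>
    using that by (simp add: alive_def occurs_def f_def descent_def)
  have fX: "of_bool (alive \<xi> \<kappa> (\<lambda>v. X (length v)) s \<omega> v) = f v (\<lambda>n. X n \<omega>)" if "v \<in> labels" for v \<omega>
    using that by (simp add: alive_generation f_def lessThan_Suc_atMost)
  have mY: "(\<lambda>\<omega>. f v (\<lambda>n. Y (descent v n) \<omega>)) \<in> borel_measurable M" if "v \<in> labels" for v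
    using f by (rule measurable_compose[rotated])
      (rule measurable_PiM_single', use Y_measurable descent_in_labels[OF that] in \<open>auto dest: measurable_space\<close>)
  have mX: "(\<lambda>\<omega>. f v (\<lambda>n. X n \<omega>)) \<in> borel_measurable P" for v
    using f by (rule measurable_compose[rotated]) (rule measurable_PiM_single', auto)
  have "(\<integral>\<^sup>+\<omega>. num_alive \<xi> \<kappa> Y s \<omega> \<partial>M) =
      (\<integral>\<^sup>+\<omega>. \<integral>\<^sup>+v. f v (\<lambda>n. Y (descent v n) \<omega>) \<partial>count_space labels \<partial>M)"
    unfolding num_alive_eq_nn_integral by (intro nn_integral_cong) (simp add: fY)
  also have "\<dots> = (\<integral>\<^sup>+v. \<integral>\<^sup>+\<omega>. f v (\<lambda>n. Y (descent v n) \<omega>) \<partial>M \<partial>count_space labels)"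
    by (rule nn_integral_count_space_nn_integral[OF countable_labels mY])
  also have "\<dots> = (\<integral>\<^sup>+v. \<integral>\<^sup>+\<omega>. f v (\<lambda>n. X n \<omega>) \<partial>P \<partial>count_space labels)"
    by (intro nn_integral_cong) (simp add: expectation_line)
  also have "\<dots> = (\<integral>\<^sup>+\<omega>. \<integral>\<^sup>+v. f v (\<lambda>n. X n \<omega>) \<partial>count_space labels \<partial>P)"
    by (rule nn_integral_count_space_nn_integral[OF countable_labels mX, symmetric])
  also have "\<dots> = (\<integral>\<^sup>+\<omega>. num_alive \<xi> \<kappa> (\<lambda>v. X (length v)) s \<omega> \<partial>P)"
    unfolding num_alive_eq_nn_integral by (intro nn_integral_cong) (simp add: fX)
  finally show ?thesis .
qed


text \<open>The birth time of generation \<open>n\<close> in the comparison tree. The index is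
  shifted: \<open>S_sum \<xi> X n\<close> is \<open>T (Suc n)\<close>.\<close>

definition T :: "nat \<Rightarrow> 'p \<Rightarrow> real" where "T n \<omega> = (\<Sum>i<n. \<xi> (X i \<omega>))"

text \<open>The size of generation \<open>n\<close> in the comparison tree.\<close>

definition W :: "nat \<Rightarrow> 'p \<Rightarrow> real" where "W n \<omega> = (\<Prod>i<n. real (\<kappa> (X i \<omega>)))"

lemma T_measurable [measurable]: "T n \<in> borel_measurable P"
  unfolding T_def by measurable

lemma W_measurable [measurable]: "W n \<in> borel_measurable P"
  unfolding W_def by measurable

lemma T_nonneg: "\<omega> \<in> space P \<Longrightarrow> 0 \<le> T n \<omega>"
  unfolding T_def by (intro sum_nonneg xi_X)

lemma T_Suc: "T (Suc n) \<omega> = T n \<omega> + \<xi> (X n \<omega>)"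
  by (simp add: T_def)

lemma T_mono: "\<omega> \<in> space P \<Longrightarrow> T n \<omega> \<le> T (Suc n) \<omega>"
  using xi_X by (simp add: T_Suc)

lemma W_Suc: "W (Suc n) \<omega> = W n \<omega> * real (\<kappa> (X n \<omega>))"
  by (simp add: W_def)

lemma W_nonneg: "0 \<le> W n \<omega>"
  by (simp add: W_def prod_nonneg)

lemma W_ge_1: "\<omega> \<in> space P \<Longrightarrow> 1 \<le> W n \<omega>"
  unfolding W_def by (intro prod_ge_1 order.trans[OF _ kappa_X]) auto

text \<open>The factor \<kappa> - 1 makes the weight in \<open>g_fun\<close> an increment of
  \<open>W\<close>, the form needed for summation by parts.\<close>

lemma g_fun_eq:
  "g_fun P \<xi> \<kappa> X n \<gamma> = (\<integral>\<^sup>+\<omega>. ennreal ((W (Suc n) \<omega> - W n \<omega>) * exp (- \<gamma> * T (Suc n) \<omega>)) \<partial>P)"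
  by (simp add: g_fun_def S_sum_def W_Suc flip: W_def)
     (simp add: T_def lessThan_Suc_atMost algebra_simps)

abbreviation mean_alive :: "real \<Rightarrow> ennreal" where
  "mean_alive s \<equiv> (\<integral>\<^sup>+\<omega>. num_alive \<xi> \<kappa> Y s \<omega> \<partial>M)"

lemma mean_alive_eq:
  "mean_alive s = (\<Sum>n. \<integral>\<^sup>+\<omega>. ennreal (W n \<omega>) * indicator {T n \<omega>..<T (Suc n) \<omega>} s \<partial>P)"
proof -
  have "mean_alive s = (\<integral>\<^sup>+\<omega>. (\<Sum>n. ennreal (W n \<omega>) * indicator {T n \<omega>..<T (Suc n) \<omega>} s) \<partial>P)"
    unfolding many_to_one num_alive_generation W_def T_def ..
  also have "\<dots> = (\<Sum>n. \<integral>\<^sup>+\<omega>. ennreal (W n \<omega>) * indicator {T n \<omega>..<T (Suc n) \<omega>} s \<partial>P)"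
    by (rule nn_integral_suminf) (simp add: indicator_def)
  finally show ?thesis .
qed

lemma generation_measurable [measurable]:
  "(\<lambda>(s, \<omega>). ennreal (W n \<omega>) * indicator {T n \<omega>..<T (Suc n) \<omega>} s) \<in> borel_measurable (borel \<Otimes>\<^sub>M P)"
  unfolding indicator_def atLeastLessThan_iff by measurable

text \<open>Measurability in time is read off the series over generations, each term being the
  integral over \<open>P\<close> of a jointly measurable function.\<close>

lemma mean_alive_measurable [measurable]: "mean_alive \<in> borel_measurable borel"
  unfolding mean_alive_eq by measurable

end

section \<open>Laplace transform of the mean population\<close>

lemma nn_integral_exp_Ico:
  assumes "\<gamma> > 0" "a \<le> b"
  shows "(\<integral>\<^sup>+s. ennreal (exp (- \<gamma> * s)) * indicator {a..<b} s \<partial>lborel)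
    = ennreal ((exp (- \<gamma> * a) - exp (- \<gamma> * b)) / \<gamma>)"
proof -
  have "(\<integral>\<^sup>+s. ennreal (exp (- \<gamma> * s)) * indicator {a..<b} s \<partial>lborel) =
      (\<integral>\<^sup>+s. ennreal (exp (- \<gamma> * s)) * indicator {a..b} s \<partial>lborel)"
    by (rule nn_integral_cong_AE)
       (use AE_lborel_singleton[of b] in \<open>auto elim!: eventually_mono simp: indicator_def\<close>)
  also have "\<dots> = ennreal ((- exp (- \<gamma> * b) / \<gamma>) - (- exp (- \<gamma> * a) / \<gamma>))"
    by (rule nn_integral_FTC_Icc) (use assms in \<open>auto intro!: derivative_eq_intros\<close>)
  finally show ?thesis by (simp add: diff_divide_distrib)
qed

context branching_model
begin

text \<open>By Tonelli the time integral may be taken first. For fixed \<omega> it integrates an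
  exponential over the lifetime interval of generation \<open>n\<close>, which lies in the half-line
  because \<open>T n\<close> is nonnegative.\<close>

lemma laplace_generation:
  assumes "\<gamma> > 0"
  shows "ennreal \<gamma> * (\<integral>\<^sup>+s. ennreal (exp (- \<gamma> * s)) * indicator {0..} s *
      (\<integral>\<^sup>+\<omega>. ennreal (W n \<omega>) * indicator {T n \<omega>..<T (Suc n) \<omega>} s \<partial>P) \<partial>lborel) =
    (\<integral>\<^sup>+\<omega>. ennreal (W n \<omega> * (exp (- \<gamma> * T n \<omega>) - exp (- \<gamma> * T (Suc n) \<omega>))) \<partial>P)"
proof -
  interpret pair_sigma_finite lborel P ..
  let ?f = "\<lambda>s \<omega>. ennreal (exp (- \<gamma> * s)) * indicator {0..} s *
    (ennreal (W n \<omega>) * indicator {T n \<omega>..<T (Suc n) \<omega>} s)"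
  have m: "case_prod ?f \<in> borel_measurable (lborel \<Otimes>\<^sub>M P)"
    unfolding indicator_def atLeastLessThan_iff atLeast_iff by measurable
  have "(\<integral>\<^sup>+s. ennreal (exp (- \<gamma> * s)) * indicator {0..} s *
      (\<integral>\<^sup>+\<omega>. ennreal (W n \<omega>) * indicator {T n \<omega>..<T (Suc n) \<omega>} s \<partial>P) \<partial>lborel) =
      (\<integral>\<^sup>+s. \<integral>\<^sup>+\<omega>. ?f s \<omega> \<partial>P \<partial>lborel)"
    by (intro nn_integral_cong nn_integral_cmult[symmetric]) (simp add: indicator_def)
  also have "\<dots> = (\<integral>\<^sup>+\<omega>. \<integral>\<^sup>+s. ?f s \<omega> \<partial>lborel \<partial>P)"
    by (rule Fubini'[OF m, symmetric])
  also have "ennreal \<gamma> * \<dots> = (\<integral>\<^sup>+\<omega>. ennreal \<gamma> * (\<integral>\<^sup>+s. ?f s \<omega> \<partial>lborel) \<partial>P)"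
    by (rule nn_integral_cmult[symmetric]) (use m in measurable)
  also have "\<dots> = (\<integral>\<^sup>+\<omega>. ennreal (W n \<omega> * (exp (- \<gamma> * T n \<omega>) - exp (- \<gamma> * T (Suc n) \<omega>))) \<partial>P)"
  proof (rule nn_integral_cong)
    fix \<omega> assume w: "\<omega> \<in> space P"
    have "(\<integral>\<^sup>+s. ?f s \<omega> \<partial>lborel) =
        (\<integral>\<^sup>+s. ennreal (W n \<omega>) * (ennreal (exp (- \<gamma> * s)) * indicator {T n \<omega>..<T (Suc n) \<omega>} s) \<partial>lborel)"
      using T_nonneg[OF w, of n] by (intro nn_integral_cong) (auto simp: indicator_def mult_ac)
    also have "\<dots> = ennreal (W n \<omega>) * ennreal ((exp (- \<gamma> * T n \<omega>) - exp (- \<gamma> * T (Suc n) \<omega>)) / \<gamma>)"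
      unfolding nn_integral_exp_Ico[OF assms T_mono[OF w], symmetric]
      by (rule nn_integral_cmult) (simp add: indicator_def)
    finally show "ennreal \<gamma> * (\<integral>\<^sup>+s. ?f s \<omega> \<partial>lborel) =
        ennreal (W n \<omega> * (exp (- \<gamma> * T n \<omega>) - exp (- \<gamma> * T (Suc n) \<omega>)))"
      using assms W_nonneg[of n \<omega>] T_mono[OF w, of n]
      by (simp add: ennreal_mult[symmetric])
  qed
  finally show ?thesis .
qed

lemma laplace_mean_alive:
  assumes "\<gamma> > 0"
  shows "ennreal \<gamma> * (\<integral>\<^sup>+s. ennreal (exp (- \<gamma> * s)) * indicator {0..} s * mean_alive s \<partial>lborel) =
    (\<Sum>n. \<integral>\<^sup>+\<omega>. ennreal (W n \<omega> * (exp (- \<gamma> * T n \<omega>) - exp (- \<gamma> * T (Suc n) \<omega>))) \<partial>P)"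
proof -
  have "(\<integral>\<^sup>+s. ennreal (exp (- \<gamma> * s)) * indicator {0..} s * mean_alive s \<partial>lborel) =
      (\<Sum>n. \<integral>\<^sup>+s. ennreal (exp (- \<gamma> * s)) * indicator {0..} s *
        (\<integral>\<^sup>+\<omega>. ennreal (W n \<omega>) * indicator {T n \<omega>..<T (Suc n) \<omega>} s \<partial>P) \<partial>lborel)"
    unfolding mean_alive_eq ennreal_suminf_cmult[symmetric]
    by (rule nn_integral_suminf) measurable
  then show ?thesis
    by (simp only: ennreal_suminf_cmult[symmetric] laplace_generation[OF assms])
qed

text \<open>Summation by parts. The boundary term stays on the left, so the identity involves no
  subtraction of extended reals; its value at generation 0 is the 1 on the right.\<close>

lemma telescope:
  assumes "\<gamma> > 0"
  shows "(\<Sum>n<N. \<integral>\<^sup>+\<omega>. ennreal (W n \<omega> * (exp (- \<gamma> * T n \<omega>) - exp (- \<gamma> * T (Suc n) \<omega>))) \<partial>P) +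
      (\<integral>\<^sup>+\<omega>. ennreal (W N \<omega> * exp (- \<gamma> * T N \<omega>)) \<partial>P) =
    1 + (\<Sum>n<N. g_fun P \<xi> \<kappa> X n \<gamma>)"
proof (induction N)
  case 0
  then show ?case by (simp add: W_def T_def P.emeasure_space_1)
next
  case (Suc N)
  let ?c = "\<lambda>n. \<integral>\<^sup>+\<omega>. ennreal (W n \<omega> * (exp (- \<gamma> * T n \<omega>) - exp (- \<gamma> * T (Suc n) \<omega>))) \<partial>P"
  let ?a = "\<lambda>n. \<integral>\<^sup>+\<omega>. ennreal (W n \<omega> * exp (- \<gamma> * T n \<omega>)) \<partial>P"
  have "?c N + ?a (Suc N) = ?a N + g_fun P \<xi> \<kappa> X N \<gamma>"
  proof -
    have "?c N + ?a (Suc N) = (\<integral>\<^sup>+\<omega>. ennreal (W N \<omega> * (exp (- \<gamma> * T N \<omega>) - exp (- \<gamma> * T (Suc N) \<omega>))) +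
        ennreal (W (Suc N) \<omega> * exp (- \<gamma> * T (Suc N) \<omega>)) \<partial>P)"
      by (rule nn_integral_add[symmetric]) measurable
    also have "\<dots> = (\<integral>\<^sup>+\<omega>. ennreal (W N \<omega> * exp (- \<gamma> * T N \<omega>)) +
        ennreal ((W (Suc N) \<omega> - W N \<omega>) * exp (- \<gamma> * T (Suc N) \<omega>)) \<partial>P)"
    proof (rule nn_integral_cong)
      fix \<omega> assume w: "\<omega> \<in> space P"
      \<comment> \<open>Pointwise this is a rearrangement of real numbers. Monotonicity of
        \<open>W\<close> and \<open>T\<close> makes all four summands nonnegative, so that
        \<open>ennreal\<close> is additive on both sides.\<close>
      have "W N \<omega> \<le> W (Suc N) \<omega>"
        using kappa_X[OF w, of N] mult_left_mono[of 1 "real (\<kappa> (X N \<omega>))" "W N \<omega>"] W_nonneg[of N \<omega>]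
        by (simp add: W_Suc)
      then show "ennreal (W N \<omega> * (exp (- \<gamma> * T N \<omega>) - exp (- \<gamma> * T (Suc N) \<omega>))) +
        ennreal (W (Suc N) \<omega> * exp (- \<gamma> * T (Suc N) \<omega>)) = ennreal (W N \<omega> * exp (- \<gamma> * T N \<omega>)) +
        ennreal ((W (Suc N) \<omega> - W N \<omega>) * exp (- \<gamma> * T (Suc N) \<omega>))"
        using T_mono[OF w, of N] W_nonneg[of N \<omega>] W_nonneg[of "Suc N" \<omega>] assms
        by (subst (1 2) ennreal_plus[symmetric]) (auto simp: algebra_simps intro!: mult_left_mono)
    qed
    also have "\<dots> = ?a N + g_fun P \<xi> \<kappa> X N \<gamma>"
      unfolding g_fun_eq by (rule nn_integral_add) measurable
    finally show ?thesis .
  qed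
  then have "(\<Sum>n<Suc N. ?c n) + ?a (Suc N) = ((\<Sum>n<N. ?c n) + ?a N) + g_fun P \<xi> \<kappa> X N \<gamma>"
    by (simp add: ac_simps)
  then show ?case unfolding Suc by (simp add: ac_simps)
qed

text \<open>Each split at least doubles the generation, so its size is at most twice its increment.
  This bounds the boundary term of \<open>telescope\<close> by a term of the series G.\<close>

lemma remainder_le:
  "(\<integral>\<^sup>+\<omega>. ennreal (W (Suc n) \<omega> * exp (- \<gamma> * T (Suc n) \<omega>)) \<partial>P) \<le> 2 * g_fun P \<xi> \<kappa> X n \<gamma>"
proof -
  have "(\<integral>\<^sup>+\<omega>. ennreal (W (Suc n) \<omega> * exp (- \<gamma> * T (Suc n) \<omega>)) \<partial>P) \<le>
      (\<integral>\<^sup>+\<omega>. 2 * ennreal ((W (Suc n) \<omega> - W n \<omega>) * exp (- \<gamma> * T (Suc n) \<omega>)) \<partial>P)"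
  proof (rule nn_integral_mono)
    fix \<omega> assume w: "\<omega> \<in> space P"
    have "2 * W n \<omega> \<le> W (Suc n) \<omega>"
      using kappa_X[OF w, of n] W_nonneg[of n \<omega>] mult_left_mono[of 2 "real (\<kappa> (X n \<omega>))" "W n \<omega>"]
      by (simp add: W_Suc)
    then have "W (Suc n) \<omega> * exp (- \<gamma> * T (Suc n) \<omega>) \<le>
        2 * ((W (Suc n) \<omega> - W n \<omega>) * exp (- \<gamma> * T (Suc n) \<omega>))"
      unfolding mult.assoc[symmetric] by (intro mult_right_mono) auto
    then show "ennreal (W (Suc n) \<omega> * exp (- \<gamma> * T (Suc n) \<omega>)) \<le>
        2 * ennreal ((W (Suc n) \<omega> - W n \<omega>) * exp (- \<gamma> * T (Suc n) \<omega>))"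
      by (subst ennreal_numeral[symmetric], subst ennreal_mult'[symmetric]) (auto intro: ennreal_leI)
  qed
  also have "\<dots> = 2 * g_fun P \<xi> \<kappa> X n \<gamma>"
    unfolding g_fun_eq by (rule nn_integral_cmult) measurable
  finally show ?thesis .
qed

lemma laplace_mean_alive_eq_G:
  assumes "\<gamma> > 0" and G: "G_fun P \<xi> \<kappa> X \<gamma> < \<infinity>"
  shows "ennreal \<gamma> * (\<integral>\<^sup>+s. ennreal (exp (- \<gamma> * s)) * indicator {0..} s * mean_alive s \<partial>lborel) =
    1 + G_fun P \<xi> \<kappa> X \<gamma>"
proof -
  let ?c = "\<lambda>n. \<integral>\<^sup>+\<omega>. ennreal (W n \<omega> * (exp (- \<gamma> * T n \<omega>) - exp (- \<gamma> * T (Suc n) \<omega>))) \<partial>P"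
  let ?a = "\<lambda>n. \<integral>\<^sup>+\<omega>. ennreal (W n \<omega> * exp (- \<gamma> * T n \<omega>)) \<partial>P"
  let ?g = "\<lambda>n. g_fun P \<xi> \<kappa> X n \<gamma>"
  have sums: "(\<lambda>N. sum f {..<N}) \<longlonglongrightarrow> suminf f" for f :: "nat \<Rightarrow> ennreal"
    using summable_sums[of f] by (simp add: sums_def)
  note sums_Suc = LIMSEQ_Suc[OF sums]
  \<comment> \<open>The terms of G tend to 0 as differences of consecutive partial sums. Finiteness
    of G makes these subtractions meaningful in \<open>ennreal\<close>.\<close>
  have "(\<lambda>N. (\<Sum>n<Suc N. ?g n) - (\<Sum>n<N. ?g n)) \<longlonglongrightarrow> suminf ?g - suminf ?g"
    by (rule tendsto_diff_ennreal[OF sums_Suc sums]) (use G in \<open>auto simp: G_fun_def\<close>)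
  moreover have "(\<Sum>n<Suc N. ?g n) - (\<Sum>n<N. ?g n) = ?g N" for N
  proof -
    have "(\<Sum>n<N. ?g n) \<le> suminf ?g" by (rule sum_le_suminf) auto
    also have "suminf ?g < top" using G by (simp only: G_fun_def infinity_ennreal_def)
    finally have "(\<Sum>n<N. ?g n) \<noteq> top" by (simp only: less_top)
    then show ?thesis unfolding sum.lessThan_Suc by (rule ennreal_add_diff_cancel_left)
  qed
  moreover have "suminf ?g - suminf ?g = 0" using G by (simp add: G_fun_def)
  ultimately have "?g \<longlonglongrightarrow> 0" by simp
  from tendsto_mult_ennreal[OF tendsto_const[of 2] this] have "(\<lambda>n. 2 * ?g n) \<longlonglongrightarrow> 0"
    by simp
  then have "(\<lambda>n. ?a (Suc n)) \<longlonglongrightarrow> 0"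
    by (rule tendsto_sandwich[OF _ always_eventually[OF allI[OF remainder_le]] tendsto_const, rotated]) simp
  \<comment> \<open>\<open>telescope\<close> is used at \<open>Suc N\<close> because
    \<open>remainder_le\<close> controls boundary terms from generation 1 on.\<close>
  from tendsto_add[OF sums_Suc this] have "(\<lambda>N. (\<Sum>n<Suc N. ?c n) + ?a (Suc N)) \<longlonglongrightarrow> suminf ?c + 0" .
  moreover have "(\<lambda>N. (\<Sum>n<Suc N. ?c n) + ?a (Suc N)) \<longlonglongrightarrow> 1 + suminf ?g"
    unfolding telescope[OF assms(1)] by (intro tendsto_intros sums_Suc)
  ultimately have "suminf ?c = 1 + suminf ?g"
    using LIMSEQ_unique by fastforce
  then show ?thesis
    unfolding laplace_mean_alive[OF assms(1)] G_fun_def .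
qed

lemma G_fun_tendsto_at_0:
  assumes "(G_fun P \<xi> \<kappa> X \<longlongrightarrow> C) (at_right 0)"
  shows "C = \<infinity>"
proof -
  \<comment> \<open>Each term of \<open>G\<close> dominates \<open>E[exp (- \<gamma> S\<^sub>n)]\<close>, which tends to 1, and there are infinitely many terms.\<close>
  define r where "r k = inverse (real (Suc k))" for k
  have r: "filterlim r (at_right 0) sequentially"
    unfolding r_def
    by (rule filterlim_compose[OF filterlim_inverse_at_right_top])
       (rule filterlim_compose[OF filterlim_real_sequentially filterlim_Suc])
  have r0: "r \<longlonglongrightarrow> 0" using r by (rule filterlim_mono) (auto simp: at_within_le_nhds)
  have rpos: "r k > 0" for k by (simp add: r_def)
  let ?e = "\<lambda>n k. \<integral>\<^sup>+\<omega>. ennreal (exp (- r k * T (Suc n) \<omega>)) \<partial>P"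
  have e_lim: "?e n \<longlonglongrightarrow> 1" for n
  proof -
    have "?e n \<longlonglongrightarrow> (\<integral>\<^sup>+\<omega>. 1 \<partial>P)"
    proof (rule nn_integral_dominated_convergence[where w = "\<lambda>_. 1"])
      show "AE \<omega> in P. ennreal (exp (- r k * T (Suc n) \<omega>)) \<le> 1" for k
        using rpos[of k] T_nonneg by (intro AE_I2) auto
      have "(\<lambda>k. ennreal (exp (- r k * T (Suc n) \<omega>))) \<longlonglongrightarrow> ennreal (exp (- 0 * T (Suc n) \<omega>))" for \<omega>
        by (intro tendsto_intros tendsto_ennrealI r0)
      then show "AE \<omega> in P. (\<lambda>k. ennreal (exp (- r k * T (Suc n) \<omega>))) \<longlonglongrightarrow> 1"
        by simp
    qed (auto simp: P.emeasure_space_1)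
    then show ?thesis by (simp add: P.emeasure_space_1)
  qed
  have e_le: "?e n k \<le> g_fun P \<xi> \<kappa> X n (r k)" for n k
    unfolding g_fun_eq
  proof (intro nn_integral_mono ennreal_leI)
    fix \<omega> assume w: "\<omega> \<in> space P"
    have "1 * 1 \<le> W n \<omega> * (real (\<kappa> (X n \<omega>)) - 1)"
      using W_ge_1[OF w, of n] kappa_X[OF w, of n] by (intro mult_mono) auto
    then have "1 \<le> W (Suc n) \<omega> - W n \<omega>" by (simp add: W_Suc algebra_simps)
    from mult_right_mono[OF this] show "exp (- r k * T (Suc n) \<omega>) \<le> (W (Suc n) \<omega> - W n \<omega>) * exp (- r k * T (Suc n) \<omega>)"
      by simp
  qed
  have "of_nat K \<le> C" for K
  proof (rule tendsto_le)
    show "(\<lambda>k. G_fun P \<xi> \<kappa> X (r k)) \<longlonglongrightarrow> C"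
      by (rule filterlim_compose[OF assms r])
    have "(\<lambda>k. \<Sum>n<K. ?e n k) \<longlonglongrightarrow> (\<Sum>n<K. 1)"
      by (intro tendsto_sum e_lim)
    then show "(\<lambda>k. \<Sum>n<K. ?e n k) \<longlonglongrightarrow> of_nat K" by simp
    show "\<forall>\<^sub>F k in sequentially. (\<Sum>n<K. ?e n k) \<le> G_fun P \<xi> \<kappa> X (r k)"
    proof (intro always_eventually allI)
      fix k
      have "(\<Sum>n<K. ?e n k) \<le> (\<Sum>n<K. g_fun P \<xi> \<kappa> X n (r k))"
        by (intro sum_mono e_le)
      also have "\<dots> \<le> G_fun P \<xi> \<kappa> X (r k)"
        unfolding G_fun_def by (rule sum_le_suminf) auto
      finally show "(\<Sum>n<K. ?e n k) \<le> G_fun P \<xi> \<kappa> X (r k)" .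
    qed
  qed simp
  then show ?thesis
    by (metis ennreal_Ex_less_of_nat infinity_ennreal_def leD less_top)
qed

end

section \<open>From Abel means to the Cesaro limit\<close>

theorem corollary2p2:
  fixes P :: "'p measure" and M :: "'m measure" and St :: "'x measure"
    and \<xi> :: "'x \<Rightarrow> real" and \<kappa> :: "'x \<Rightarrow> nat"
    and X :: "nat \<Rightarrow> 'p \<Rightarrow> 'x" and Y :: "nat list \<Rightarrow> 'm \<Rightarrow> 'x"
    and \<nu> :: real and C\<^sub>\<nu> :: ennreal
  assumes "branching_model P M St \<xi> \<kappa> X Y"
    and "malthus P \<xi> \<kappa> X < \<infinity>"
    and "\<nu> = enn2real (malthus P \<xi> \<kappa> X)"
    and "C\<^sub>\<nu> < \<infinity>"
    and "((\<lambda>\<gamma>. ennreal (\<gamma> / (\<gamma> + \<nu>)) * G_fun P \<xi> \<kappa> X (\<nu> + \<gamma>)) \<longlongrightarrow> C\<^sub>\<nu>) (at_right 0)"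
  shows "((\<lambda>t. ennreal (1 / t) *
            (\<integral>\<^sup>+s\<in>{0..t}. ennreal (exp (- \<nu> * s)) *
                (\<integral>\<^sup>+\<omega>. num_alive \<xi> \<kappa> Y s \<omega> \<partial>M) \<partial>lborel)) \<longlongrightarrow> C\<^sub>\<nu>) at_top"
proof -
  interpret branching_model P M St \<xi> \<kappa> X Y by (rule assms(1))
  let ?G = "G_fun P \<xi> \<kappa> X"
  let ?r = "\<lambda>\<gamma>. \<gamma> / (\<gamma> + \<nu>)"
  have pos: "\<forall>\<^sub>F \<gamma> in at_right 0. (\<gamma>::real) > 0" by (rule eventually_at_right_less)
  \<comment> \<open>At \<nu> = 0 the factor \<open>?r \<gamma>\<close> is 1 for every \<gamma> > 0,
    so the hypothesis would give G a finite limit at 0.\<close>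
  have "\<nu> \<noteq> 0"
  proof
    assume [simp]: "\<nu> = 0"
    have "(?G \<longlongrightarrow> C\<^sub>\<nu>) (at_right 0)"
      using assms(5) by (rule Lim_transform_eventually) (use pos in eventually_elim, simp)
    then have "C\<^sub>\<nu> = \<infinity>" by (rule G_fun_tendsto_at_0)
    with assms(4) show False by simp
  qed
  then have \<nu>: "\<nu> > 0"
    using assms(3) by (metis order_le_less enn2real_nonneg)
  obtain c where c: "C\<^sub>\<nu> = ennreal c" "c \<ge> 0"
    using assms(4) by (cases C\<^sub>\<nu>) auto
  \<comment> \<open>The mass of [0, t] under \<open>N\<close> is the integral in the claim, and the
    Laplace transform of \<open>N\<close> at \<gamma> is that of \<open>mean_alive\<close> at \<nu>
    + \<gamma>.\<close>
  define N where "N = density lborel (\<lambda>s. ennreal (exp (- \<nu> * s)) * mean_alive s)"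
  \<comment> \<open>Finiteness of G just to the right of \<nu> is drawn from the finite limit
    \<open>C\<^sub>\<nu>\<close>: the factor \<open>?r \<gamma>\<close> is positive, so a finite
    product forces a finite G.\<close>
  have fin: "\<forall>\<^sub>F \<gamma> in at_right 0. ennreal (?r \<gamma>) * ?G (\<nu> + \<gamma>) < \<infinity>"
    by (rule order_tendstoD(2)[OF assms(5,4)])
  have "((\<lambda>\<gamma>. ennreal (?r \<gamma>) + ennreal (?r \<gamma>) * ?G (\<nu> + \<gamma>)) \<longlongrightarrow> 0 + C\<^sub>\<nu>) (at_right 0)"
  proof (intro tendsto_add assms(5))
    have "(?r \<longlongrightarrow> 0 / (0 + \<nu>)) (at_right 0)"
      using \<nu> by (intro tendsto_intros) auto
    from tendsto_ennrealI[OF this] show "((\<lambda>\<gamma>. ennreal (?r \<gamma>)) \<longlongrightarrow> 0) (at_right 0)"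
      by simp
  qed
  then have "((\<lambda>\<gamma>. ennreal \<gamma> * (\<integral>\<^sup>+s. ennreal (exp (- \<gamma> * s)) * indicator {0..} s \<partial>N)) \<longlongrightarrow> 0 + C\<^sub>\<nu>)
    (at_right 0)"
  proof (rule Lim_transform_eventually)
    show "\<forall>\<^sub>F \<gamma> in at_right 0. ennreal (?r \<gamma>) + ennreal (?r \<gamma>) * ?G (\<nu> + \<gamma>) =
        ennreal \<gamma> * (\<integral>\<^sup>+s. ennreal (exp (- \<gamma> * s)) * indicator {0..} s \<partial>N)"
      using fin pos
    proof eventually_elim
      case (elim \<gamma>)
      let ?L = "\<integral>\<^sup>+s. ennreal (exp (- (\<nu> + \<gamma>) * s)) * indicator {0..} s * mean_alive s \<partial>lborel"
      have "?r \<gamma> > 0" using elim \<nu> by simp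
      with elim have "?G (\<nu> + \<gamma>) < \<infinity>"
        by (auto simp: ennreal_mult_less_top ennreal_eq_0_iff)
      with elim \<nu> have L: "ennreal (\<nu> + \<gamma>) * ?L = 1 + ?G (\<nu> + \<gamma>)"
        by (intro laplace_mean_alive_eq_G) auto
      have "(\<integral>\<^sup>+s. ennreal (exp (- \<gamma> * s)) * indicator {0..} s \<partial>N) =
          (\<integral>\<^sup>+s. ennreal (exp (- \<nu> * s)) * mean_alive s * (ennreal (exp (- \<gamma> * s)) * indicator {0..} s) \<partial>lborel)"
        unfolding N_def by (rule nn_integral_density) measurable
      also have "\<dots> = ?L"
      proof (rule nn_integral_cong)
        fix s
        have "ennreal (exp (- (\<nu> + \<gamma>) * s)) = ennreal (exp (- \<nu> * s)) * ennreal (exp (- \<gamma> * s))"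
          by (simp add: ennreal_mult[symmetric] mult_exp_exp algebra_simps)
        then show "ennreal (exp (- \<nu> * s)) * mean_alive s * (ennreal (exp (- \<gamma> * s)) * indicator {0..} s) =
            ennreal (exp (- (\<nu> + \<gamma>) * s)) * indicator {0..} s * mean_alive s"
          by (simp only: mult_ac)
      qed
      finally have "ennreal \<gamma> * (\<integral>\<^sup>+s. ennreal (exp (- \<gamma> * s)) * indicator {0..} s \<partial>N) = ennreal \<gamma> * ?L"
        by (rule arg_cong)
      also have "\<dots> = ennreal (?r \<gamma>) * (ennreal (\<nu> + \<gamma>) * ?L)"
      proof -
        \<comment> \<open>The transform identity carries the prefactor \<nu> + \<gamma> whereas the
          Abel mean carries \<gamma>; their ratio is \<open>?r \<gamma>\<close>.\<close>
        have "ennreal \<gamma> = ennreal (?r \<gamma>) * ennreal (\<nu> + \<gamma>)"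
          using elim \<nu> by (subst ennreal_mult[symmetric]) (auto simp: add.commute)
        then show ?thesis by (simp only: mult.assoc)
      qed
      also have "\<dots> = ennreal (?r \<gamma>) + ennreal (?r \<gamma>) * ?G (\<nu> + \<gamma>)"
        unfolding L by (simp add: distrib_left)
      finally show ?case by (rule sym)
    qed
  qed
  then have "((\<lambda>t. ennreal (1 / t) * emeasure N {0..t}) \<longlongrightarrow> C\<^sub>\<nu>) at_top"
    unfolding c(1) add_0_left by (intro karamata_tauberian c(2)) (simp_all add: N_def)
  moreover have "emeasure N {0..t} =
      (\<integral>\<^sup>+s\<in>{0..t}. ennreal (exp (- \<nu> * s)) * mean_alive s \<partial>lborel)" for t
    unfolding N_def by (rule emeasure_density) measurable
  ultimately show ?thesis by (simp only:)
qed

end
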